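(* Let $\kappa$ be a field and $D_\infty=\langle a,b\mid b^2=1,\ ba=a^{-1}b\rangle$ the infinite dihedral group. Let $pm(D_\infty)_{\operatorname{diag}}\subseteq pm(D_\infty)$ be the set of all diagonal factor sets of $D_\infty$ (a semigroup under pointwise multiplication). Then $pm(D_\infty)_{\operatorname{diag}}\cong\{0,1\}^{\mathbb{Z}^+\sqcup\,\mathbb{Z}}$ as semigroups.
   Context: $pm(D_\infty)$ denotes the semigroup, under pointwise multiplication, of all factor sets $D_\infty\times D_\infty\to\kappa$ of partial projective representations of $D_\infty$ over $\kappa$. A diagonal factor set of a group $G$ is a function of the form $\sigma_S:G\times G\to\{0,1\}\subseteq\kappa$, where $S\subseteq G$ satisfies $1\notin S$ and $g^{-1}\in S$ for all $g\in S$, and $\sigma_S(x,y)=0$ if $\{x,y,xy\}\cap S\neq\varnothing$, $\sigma_S(x,y)=1$ otherwise; every such $\sigma_S$ belongs to $pm(G)$. $\mathbb{Z}^+$ is the set of positive integers, and $\{0,1\}^{\mathbb{Z}^+\sqcup\,\mathbb{Z}}$ is the set of all functions from the disjoint union $\mathbb{Z}^+\sqcup\mathbb{Z}$ to $\{0,1\}$, with pointwise multiplication. *)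

theory Defs
  imports "HOL-Algebra.Algebra"
begin

section \<open>Partial projective representations and factor sets\<close>

record ('k, 'm) kmonoid = "'m monoid" +
  kzero :: 'm
  kscale :: "'k \<Rightarrow> 'm \<Rightarrow> 'm"

locale cancellative_kmonoid = K: field K + M: monoid M
  for K :: "('k, 'c) ring_scheme" and M :: "('k, 'm, 'd) kmonoid_scheme" +
  assumes kzero_closed: "kzero M \<in> carrier M"
    and kzero_left: "x \<in> carrier M \<Longrightarrow> kzero M \<otimes>\<^bsub>M\<^esub> x = kzero M"
    and kzero_right: "x \<in> carrier M \<Longrightarrow> x \<otimes>\<^bsub>M\<^esub> kzero M = kzero M"
    and kscale_closed:
      "\<alpha> \<in> carrier K \<Longrightarrow> x \<in> carrier M \<Longrightarrow> kscale M \<alpha> x \<in> carrier M"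
    and kscale_one: "x \<in> carrier M \<Longrightarrow> kscale M \<one>\<^bsub>K\<^esub> x = x"
    and kscale_zero: "x \<in> carrier M \<Longrightarrow> kscale M \<zero>\<^bsub>K\<^esub> x = kzero M"
    and kscale_kscale:
      "\<alpha> \<in> carrier K \<Longrightarrow> \<beta> \<in> carrier K \<Longrightarrow> x \<in> carrier M \<Longrightarrow>
        kscale M \<alpha> (kscale M \<beta> x) = kscale M (\<alpha> \<otimes>\<^bsub>K\<^esub> \<beta>) x"
    and kscale_mult_left:
      "\<alpha> \<in> carrier K \<Longrightarrow> x \<in> carrier M \<Longrightarrow> y \<in> carrier M \<Longrightarrow>
        kscale M \<alpha> (x \<otimes>\<^bsub>M\<^esub> y) = kscale M \<alpha> x \<otimes>\<^bsub>M\<^esub> y"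
    and kscale_mult_right:
      "\<alpha> \<in> carrier K \<Longrightarrow> x \<in> carrier M \<Longrightarrow> y \<in> carrier M \<Longrightarrow>
        kscale M \<alpha> (x \<otimes>\<^bsub>M\<^esub> y) = x \<otimes>\<^bsub>M\<^esub> kscale M \<alpha> y"
    and kscale_cancel:
      "\<alpha> \<in> carrier K \<Longrightarrow> \<beta> \<in> carrier K \<Longrightarrow> x \<in> carrier M \<Longrightarrow> x \<noteq> kzero M \<Longrightarrow>
        kscale M \<alpha> x = kscale M \<beta> x \<Longrightarrow> \<alpha> = \<beta>"

text \<open>
  \<open>\<Gamma>\<close> is a partial projective representation of \<open>G\<close> in the \<open>K\<close>-cancellative monoid \<open>M\<close>, and
  \<open>\<sigma>\<close> is its factor set, extended by \<open>\<zero>\<close> to the pairs with \<open>\<Gamma> x \<Gamma> y = 0\<close>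
  (Dokuchaev and Novikov). The conditions determine \<open>\<sigma>\<close> from \<open>\<Gamma>\<close> because \<open>M\<close> is
  \<open>K\<close>-cancellative.
\<close>

definition proj_rep_with_factor_set ::
  "('k, 'c) ring_scheme \<Rightarrow> ('g, 'b) monoid_scheme \<Rightarrow> ('k, 'm, 'd) kmonoid_scheme \<Rightarrow>
    ('g \<Rightarrow> 'm) \<Rightarrow> ('g \<times> 'g \<Rightarrow> 'k) \<Rightarrow> bool" where
  "proj_rep_with_factor_set K G M \<Gamma> \<sigma> \<longleftrightarrow>
     cancellative_kmonoid K M \<and>
     \<Gamma> \<in> carrier G \<rightarrow> carrier M \<and>
     \<Gamma> \<one>\<^bsub>G\<^esub> = \<one>\<^bsub>M\<^esub> \<and>
     \<sigma> \<in> carrier G \<times> carrier G \<rightarrow>\<^sub>E carrier K \<and>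
     (\<forall>x\<in>carrier G. \<forall>y\<in>carrier G.
        (\<Gamma> (inv\<^bsub>G\<^esub> x) \<otimes>\<^bsub>M\<^esub> \<Gamma> (x \<otimes>\<^bsub>G\<^esub> y) = kzero M \<longleftrightarrow> \<Gamma> x \<otimes>\<^bsub>M\<^esub> \<Gamma> y = kzero M) \<and>
        (\<Gamma> (x \<otimes>\<^bsub>G\<^esub> y) \<otimes>\<^bsub>M\<^esub> \<Gamma> (inv\<^bsub>G\<^esub> y) = kzero M \<longleftrightarrow> \<Gamma> x \<otimes>\<^bsub>M\<^esub> \<Gamma> y = kzero M) \<and>
        (\<sigma> (x, y) = \<zero>\<^bsub>K\<^esub> \<longleftrightarrow> \<Gamma> x \<otimes>\<^bsub>M\<^esub> \<Gamma> y = kzero M) \<and>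
        (\<Gamma> x \<otimes>\<^bsub>M\<^esub> \<Gamma> y \<noteq> kzero M \<longrightarrow>
           \<Gamma> (inv\<^bsub>G\<^esub> x) \<otimes>\<^bsub>M\<^esub> \<Gamma> x \<otimes>\<^bsub>M\<^esub> \<Gamma> y =
             kscale M (\<sigma> (x, y)) (\<Gamma> (inv\<^bsub>G\<^esub> x) \<otimes>\<^bsub>M\<^esub> \<Gamma> (x \<otimes>\<^bsub>G\<^esub> y)) \<and>
           \<Gamma> x \<otimes>\<^bsub>M\<^esub> \<Gamma> y \<otimes>\<^bsub>M\<^esub> \<Gamma> (inv\<^bsub>G\<^esub> y) =
             kscale M (\<sigma> (x, y)) (\<Gamma> (x \<otimes>\<^bsub>G\<^esub> y) \<otimes>\<^bsub>M\<^esub> \<Gamma> (inv\<^bsub>G\<^esub> y))))"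

text \<open>
  The definition of \<open>pm\<close> ranges over all \<open>K\<close>-cancellative monoids. Fixing the type of their
  elements to \<open>'k \<times> 'g list\<close> is no restriction (lemma \<open>pm_memI\<close> below): only the submonoid
  \<open>{\<alpha> \<Gamma>(x\<^sub>1) \<dots> \<Gamma>(x\<^sub>n)}\<close> matters.
  The unit in the record plays no role: \<open>pm K G\<close> is used as a semigroup only.
\<close>

definition pm ::
  "('k, 'c) ring_scheme \<Rightarrow> ('g, 'b) monoid_scheme \<Rightarrow> ('g \<times> 'g \<Rightarrow> 'k) monoid" where
  "pm K G =
     \<lparr>carrier = {\<sigma>. \<exists>(M :: ('k, 'k \<times> 'g list) kmonoid) \<Gamma>.
                   proj_rep_with_factor_set K G M \<Gamma> \<sigma>},
      monoid.mult = (\<lambda>\<sigma> \<tau>. \<lambda>p\<in>carrier G \<times> carrier G. \<sigma> p \<otimes>\<^bsub>K\<^esub> \<tau> p),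
      one = (\<lambda>p\<in>carrier G \<times> carrier G. \<one>\<^bsub>K\<^esub>)\<rparr>"

definition diag_support :: "('g, 'b) monoid_scheme \<Rightarrow> 'g set \<Rightarrow> bool" where
  "diag_support G S \<longleftrightarrow> S \<subseteq> carrier G \<and> \<one>\<^bsub>G\<^esub> \<notin> S \<and> (\<forall>g\<in>S. inv\<^bsub>G\<^esub> g \<in> S)"

definition diag_factor_set ::
  "('k, 'c) ring_scheme \<Rightarrow> ('g, 'b) monoid_scheme \<Rightarrow> 'g set \<Rightarrow> 'g \<times> 'g \<Rightarrow> 'k" where
  "diag_factor_set K G S =
     (\<lambda>(x, y)\<in>carrier G \<times> carrier G.
        if {x, y, x \<otimes>\<^bsub>G\<^esub> y} \<inter> S \<noteq> {} then \<zero>\<^bsub>K\<^esub> else \<one>\<^bsub>K\<^esub>)"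

definition pm_diag ::
  "('k, 'c) ring_scheme \<Rightarrow> ('g, 'b) monoid_scheme \<Rightarrow> ('g \<times> 'g \<Rightarrow> 'k) monoid" where
  "pm_diag K G =
     (pm K G)\<lparr>carrier :=
       {\<sigma> \<in> carrier (pm K G). \<exists>S. diag_support G S \<and> \<sigma> = diag_factor_set K G S}\<rparr>"

definition zero_one_functions :: "'i set \<Rightarrow> ('i \<Rightarrow> nat) monoid" where
  "zero_one_functions I =
     \<lparr>carrier = I \<rightarrow>\<^sub>E {0, 1}, monoid.mult = (\<lambda>f g. \<lambda>i\<in>I. f i * g i), one = (\<lambda>i\<in>I. 1)\<rparr>"


lemma proj_rep_transport:
  fixes M :: "('k, 'm, 'd) kmonoid_scheme" and s :: "'m \<Rightarrow> 'n"
  assumes G: "group G"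
    and pr: "proj_rep_with_factor_set K G M \<Gamma> \<sigma>"
    and N: "N \<subseteq> carrier M" "\<one>\<^bsub>M\<^esub> \<in> N" "kzero M \<in> N" "\<And>x. x \<in> carrier G \<Longrightarrow> \<Gamma> x \<in> N"
      "\<And>x y. x \<in> N \<Longrightarrow> y \<in> N \<Longrightarrow> x \<otimes>\<^bsub>M\<^esub> y \<in> N"
      "\<And>\<alpha> x. \<alpha> \<in> carrier K \<Longrightarrow> x \<in> N \<Longrightarrow> kscale M \<alpha> x \<in> N"
    and ts: "\<And>x. x \<in> N \<Longrightarrow> t (s x) = x"
  shows "proj_rep_with_factor_set K G
     \<lparr>carrier = s ` N, monoid.mult = (\<lambda>p q. s (t p \<otimes>\<^bsub>M\<^esub> t q)), one = s \<one>\<^bsub>M\<^esub>,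
      kzero = s (kzero M), kscale = (\<lambda>\<alpha> p. s (kscale M \<alpha> (t p)))\<rparr> (s \<circ> \<Gamma>) \<sigma>"
proof -
  have inj: "s x = s y \<longleftrightarrow> x = y" if "x \<in> N" "y \<in> N" for x y
    using ts that by metis
  interpret G: group G by (rule G)
  interpret M: cancellative_kmonoid K M
    using pr by (simp add: proj_rep_with_factor_set_def)
  have NM: "x \<in> carrier M" if "x \<in> N" for x using N(1) that by blast
  define M' where "M' =
     \<lparr>carrier = s ` N, monoid.mult = (\<lambda>p q. s (t p \<otimes>\<^bsub>M\<^esub> t q)), one = s \<one>\<^bsub>M\<^esub>,
      kzero = s (kzero M), kscale = (\<lambda>\<alpha> p. s (kscale M \<alpha> (t p)))\<rparr>"
  have carrier': "carrier M' = s ` N" and one': "\<one>\<^bsub>M'\<^esub> = s \<one>\<^bsub>M\<^esub>"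
    and kzero': "kzero M' = s (kzero M)"
    by (simp_all add: M'_def)
  have mult': "s x \<otimes>\<^bsub>M'\<^esub> s y = s (x \<otimes>\<^bsub>M\<^esub> y)" if "x \<in> N" "y \<in> N" for x y
    using that by (simp add: M'_def ts)
  have scale': "kscale M' \<alpha> (s x) = s (kscale M \<alpha> x)" if "x \<in> N" for \<alpha> x
    using that by (simp add: M'_def ts)
  have sN: "s x \<in> carrier M'" if "x \<in> N" for x using that by (simp add: carrier')
  have "cancellative_kmonoid K M'"
  proof unfold_locales
    show "\<one>\<^bsub>M'\<^esub> \<in> carrier M'" "kzero M' \<in> carrier M'" by (simp_all add: one' kzero' sN N)
  next
    fix p assume "p \<in> carrier M'"
    then obtain x where x: "x \<in> N" "p = s x" by (auto simp: carrier')
    show "\<one>\<^bsub>M'\<^esub> \<otimes>\<^bsub>M'\<^esub> p = p" "p \<otimes>\<^bsub>M'\<^esub> \<one>\<^bsub>M'\<^esub> = p"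
      "kzero M' \<otimes>\<^bsub>M'\<^esub> p = kzero M'" "p \<otimes>\<^bsub>M'\<^esub> kzero M' = kzero M'"
      "kscale M' \<one>\<^bsub>K\<^esub> p = p" "kscale M' \<zero>\<^bsub>K\<^esub> p = kzero M'"
      using x(1) by (simp_all add: x(2) one' kzero' mult' scale' N(2,3) NM M.kzero_left
          M.kzero_right M.kscale_one M.kscale_zero)
    fix q assume "q \<in> carrier M'"
    then obtain y where y: "y \<in> N" "q = s y" by (auto simp: carrier')
    show "p \<otimes>\<^bsub>M'\<^esub> q \<in> carrier M'" using x y by (simp add: mult' sN N(5))
    show "kscale M' \<alpha> (p \<otimes>\<^bsub>M'\<^esub> q) = kscale M' \<alpha> p \<otimes>\<^bsub>M'\<^esub> q" if "\<alpha> \<in> carrier K" for \<alpha>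
      using x y that by (simp add: mult' scale' N(5,6) NM M.kscale_mult_left)
    show "kscale M' \<alpha> (p \<otimes>\<^bsub>M'\<^esub> q) = p \<otimes>\<^bsub>M'\<^esub> kscale M' \<alpha> q" if "\<alpha> \<in> carrier K" for \<alpha>
      using x y that by (simp add: mult' scale' N(5,6) NM M.kscale_mult_right)
    fix r assume "r \<in> carrier M'"
    then obtain z where z: "z \<in> N" "r = s z" by (auto simp: carrier')
    show "p \<otimes>\<^bsub>M'\<^esub> q \<otimes>\<^bsub>M'\<^esub> r = p \<otimes>\<^bsub>M'\<^esub> (q \<otimes>\<^bsub>M'\<^esub> r)"
      using x y z by (simp add: mult' N(5) NM M.M.m_assoc)
  next
    fix \<alpha> p assume \<alpha>: "\<alpha> \<in> carrier K" and "p \<in> carrier M'"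
    then obtain x where x: "x \<in> N" "p = s x" by (auto simp: carrier')
    show "kscale M' \<alpha> p \<in> carrier M'" using \<alpha> x by (simp add: scale' sN N(6))
    fix \<beta> assume \<beta>: "\<beta> \<in> carrier K"
    show "kscale M' \<alpha> (kscale M' \<beta> p) = kscale M' (\<alpha> \<otimes>\<^bsub>K\<^esub> \<beta>) p"
      using \<alpha> \<beta> x by (simp add: scale' N(6) NM M.kscale_kscale)
    assume "p \<noteq> kzero M'" "kscale M' \<alpha> p = kscale M' \<beta> p"
    then have "x \<noteq> kzero M" "kscale M \<alpha> x = kscale M \<beta> x"
      using \<alpha> \<beta> x by (auto simp: kzero' scale' inj N(6))
    then show "\<alpha> = \<beta>" using M.kscale_cancel[OF \<alpha> \<beta> NM[OF x(1)]] by blast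
  qed
  moreover have \<sigma>: "\<sigma> \<in> carrier G \<times> carrier G \<rightarrow>\<^sub>E carrier K"
    using pr by (simp add: proj_rep_with_factor_set_def)
  moreover have "\<sigma> (x, y) \<in> carrier K" if "x \<in> carrier G" "y \<in> carrier G" for x y
    using PiE_mem[OF \<sigma>, of "(x, y)"] that by simp
  moreover have "s \<circ> \<Gamma> \<in> carrier G \<rightarrow> carrier M'" "(s \<circ> \<Gamma>) \<one>\<^bsub>G\<^esub> = \<one>\<^bsub>M'\<^esub>"
    using pr N(4) by (auto simp: sN one' proj_rep_with_factor_set_def)
  ultimately have "proj_rep_with_factor_set K G M' (s \<circ> \<Gamma>) \<sigma>"
    using pr unfolding proj_rep_with_factor_set_def
    by (simp add: kzero' mult' scale' inj N(3-6))
  then show ?thesis unfolding M'_def .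
qed

lemma pm_memI:
  fixes M :: "('k, 'm, 'd) kmonoid_scheme"
  assumes G: "group G" and pr: "proj_rep_with_factor_set K G M \<Gamma> \<sigma>"
  shows "\<sigma> \<in> carrier (pm K G)"
proof -
  interpret G: group G by (rule G)
  interpret M: cancellative_kmonoid K M
    using pr by (simp add: proj_rep_with_factor_set_def)
  have \<Gamma>: "\<Gamma> x \<in> carrier M" if "x \<in> carrier G" for x
    using pr that by (auto simp: proj_rep_with_factor_set_def)
  define ev where "ev w = foldr (\<lambda>x m. \<Gamma> x \<otimes>\<^bsub>M\<^esub> m) w \<one>\<^bsub>M\<^esub>" for w
  have ev_M: "ev w \<in> carrier M" if "set w \<subseteq> carrier G" for w
    using that by (induction w) (auto simp: ev_def \<Gamma>)
  have ev_append: "ev (v @ w) = ev v \<otimes>\<^bsub>M\<^esub> ev w"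
    if "set v \<subseteq> carrier G" "set w \<subseteq> carrier G" for v w
    using that
  proof (induction v)
    case Nil
    then show ?case using ev_M[of w] by (simp add: ev_def)
  next
    case (Cons x v)
    then have "ev ((x # v) @ w) = \<Gamma> x \<otimes>\<^bsub>M\<^esub> (ev v \<otimes>\<^bsub>M\<^esub> ev w)" by (simp add: ev_def)
    also have "\<dots> = ev (x # v) \<otimes>\<^bsub>M\<^esub> ev w"
      using Cons.prems ev_M[of v] ev_M[of w] by (simp add: ev_def \<Gamma> M.M.m_assoc)
    finally show ?case .
  qed
  define t where "t = (\<lambda>(\<alpha>, w). kscale M \<alpha> (ev w))"
  define D where "D = carrier K \<times> {w. set w \<subseteq> carrier G}"
  define s where "s = inv_into D t"
  have tI: "kscale M \<alpha> (ev w) \<in> t ` D" if "\<alpha> \<in> carrier K" "set w \<subseteq> carrier G" for \<alpha> w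
    using that by (force simp: t_def D_def)
  have N: "\<exists>\<alpha> w. \<alpha> \<in> carrier K \<and> set w \<subseteq> carrier G \<and> x = kscale M \<alpha> (ev w)" if "x \<in> t ` D" for x
    using that by (auto simp: t_def D_def)
  have "proj_rep_with_factor_set K G
     \<lparr>carrier = s ` t ` D, monoid.mult = (\<lambda>p q. s (t p \<otimes>\<^bsub>M\<^esub> t q)), one = s \<one>\<^bsub>M\<^esub>,
      kzero = s (kzero M), kscale = (\<lambda>\<alpha> p. s (kscale M \<alpha> (t p)))\<rparr> (s \<circ> \<Gamma>) \<sigma>"
  proof (rule proj_rep_transport[OF G pr])
    show "t ` D \<subseteq> carrier M"
      by (auto simp: t_def D_def ev_M M.kscale_closed)
    show "\<one>\<^bsub>M\<^esub> \<in> t ` D"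
      using tI[of "\<one>\<^bsub>K\<^esub>" "[]"] by (simp add: ev_def M.kscale_one)
    show "kzero M \<in> t ` D"
      using tI[of "\<zero>\<^bsub>K\<^esub>" "[]"] by (simp add: ev_def M.kscale_zero)
    show "\<Gamma> x \<in> t ` D" if "x \<in> carrier G" for x
      using tI[of "\<one>\<^bsub>K\<^esub>" "[x]"] that by (simp add: ev_def M.kscale_one \<Gamma>)
    show "kscale M \<alpha> x \<in> t ` D" if x: "\<alpha> \<in> carrier K" "x \<in> t ` D" for \<alpha> x
    proof -
      obtain \<beta> w where "\<beta> \<in> carrier K" "set w \<subseteq> carrier G" "x = kscale M \<beta> (ev w)"
        using N[OF x(2)] by blast
      then show ?thesis using tI[of "\<alpha> \<otimes>\<^bsub>K\<^esub> \<beta>" w] x(1) by (simp add: M.kscale_kscale ev_M)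
    qed
    show "x \<otimes>\<^bsub>M\<^esub> y \<in> t ` D" if xy: "x \<in> t ` D" "y \<in> t ` D" for x y
    proof -
      obtain \<alpha> v \<beta> w where *: "\<alpha> \<in> carrier K" "set v \<subseteq> carrier G" "x = kscale M \<alpha> (ev v)"
          "\<beta> \<in> carrier K" "set w \<subseteq> carrier G" "y = kscale M \<beta> (ev w)"
        using N[OF xy(1)] N[OF xy(2)] by blast
      have "x \<otimes>\<^bsub>M\<^esub> y = kscale M \<alpha> (ev v \<otimes>\<^bsub>M\<^esub> kscale M \<beta> (ev w))"
        using * by (simp add: ev_M M.kscale_closed M.kscale_mult_left)
      also have "\<dots> = kscale M (\<alpha> \<otimes>\<^bsub>K\<^esub> \<beta>) (ev (v @ w))"
        using * by (simp add: ev_append ev_M M.kscale_mult_right[symmetric] M.kscale_kscale)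
      finally have "x \<otimes>\<^bsub>M\<^esub> y = kscale M (\<alpha> \<otimes>\<^bsub>K\<^esub> \<beta>) (ev (v @ w))" .
      then show ?thesis using tI[of "\<alpha> \<otimes>\<^bsub>K\<^esub> \<beta>" "v @ w"] * by simp
    qed
    show "t (s x) = x" if "x \<in> t ` D" for x
      using that by (simp add: s_def f_inv_into_f)
  qed
  then show ?thesis unfolding pm_def by auto
qed

text \<open>
  Realisation of \<open>\<sigma>\<^sub>S\<close>: \<open>x\<close> acts by left translation on the subsets \<open>A\<close> of \<open>G\<close> with
  \<open>1 \<in> A\<close> and \<open>A\<inverse>A \<inter> S = \<emptyset>\<close>, defined when \<open>x\<inverse> \<in> A\<close>; the monoid consists of scalar multiples
  of such partial maps.
\<close>

lemma diag_factor_set_mem_pm: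
  fixes K :: "('k, 'c) ring_scheme" and G :: "('g, 'b) monoid_scheme"
  assumes K: "field K" and G: "group G" and S: "diag_support G S"
  shows "diag_factor_set K G S \<in> carrier (pm K G)"
proof -
  interpret K: field K by (rule K)
  interpret G: group G by (rule G)
  have S_inv: "inv\<^bsub>G\<^esub> g \<in> S" if "g \<in> S" for g
    using S that by (auto simp: diag_support_def)
  have S_one: "\<one>\<^bsub>G\<^esub> \<notin> S" using S by (simp add: diag_support_def)
  have S_inv_iff: "inv\<^bsub>G\<^esub> g \<in> S \<longleftrightarrow> g \<in> S" if "g \<in> carrier G" for g
    using S_inv[of g] S_inv[of "inv\<^bsub>G\<^esub> g"] that by auto
  define Z where "Z = {Y. Y \<subseteq> carrier G \<and> \<one>\<^bsub>G\<^esub> \<in> Y \<and> (\<forall>u\<in>Y. \<forall>v\<in>Y. inv\<^bsub>G\<^esub> u \<otimes>\<^bsub>G\<^esub> v \<notin> S)}"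
  define L where "L x = (\<lambda>Y. if Y \<in> Z \<and> inv\<^bsub>G\<^esub> x \<in> Y then Some ((\<lambda>y. x \<otimes>\<^bsub>G\<^esub> y) ` Y) else None)" for x
  define P where "P c f = (if f = Map.empty then \<zero>\<^bsub>K\<^esub> else c, f)"
    for c :: 'k and f :: "'g set \<Rightarrow> 'g set option"
  define M :: "('k, 'k \<times> ('g set \<Rightarrow> 'g set option)) kmonoid" where
    "M = \<lparr>carrier = {(c, f). c \<in> carrier K \<and> (c = \<zero>\<^bsub>K\<^esub> \<longleftrightarrow> f = Map.empty) \<and> dom f \<subseteq> Z \<and> ran f \<subseteq> Z},
          monoid.mult = (\<lambda>(c, f) (d, g). P (c \<otimes>\<^bsub>K\<^esub> d) (f \<circ>\<^sub>m g)),
          one = (\<one>\<^bsub>K\<^esub>, L \<one>\<^bsub>G\<^esub>),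
          kzero = (\<zero>\<^bsub>K\<^esub>, Map.empty),
          kscale = (\<lambda>a (c, f). if a = \<zero>\<^bsub>K\<^esub> then (\<zero>\<^bsub>K\<^esub>, Map.empty) else (a \<otimes>\<^bsub>K\<^esub> c, f))\<rparr>"
  have ZG: "y \<in> carrier G" if "Y \<in> Z" "y \<in> Y" for y Y using that by (auto simp: Z_def)
  have Z_one: "\<one>\<^bsub>G\<^esub> \<in> Y" if "Y \<in> Z" for Y using that by (auto simp: Z_def)
  have canc: "inv\<^bsub>G\<^esub> x \<otimes>\<^bsub>G\<^esub> (x \<otimes>\<^bsub>G\<^esub> y) = y" if "x \<in> carrier G" "y \<in> carrier G" for x y
    using that by (simp add: G.m_assoc[symmetric])
  have shift: "(\<lambda>y. x \<otimes>\<^bsub>G\<^esub> y) ` Y \<in> Z" if x: "x \<in> carrier G" "Y \<in> Z" "inv\<^bsub>G\<^esub> x \<in> Y" for x Y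
  proof -
    have "\<one>\<^bsub>G\<^esub> \<in> (\<lambda>y. x \<otimes>\<^bsub>G\<^esub> y) ` Y" using x by (metis G.r_inv image_eqI)
    moreover have "inv\<^bsub>G\<^esub> (x \<otimes>\<^bsub>G\<^esub> u) \<otimes>\<^bsub>G\<^esub> (x \<otimes>\<^bsub>G\<^esub> v) = inv\<^bsub>G\<^esub> u \<otimes>\<^bsub>G\<^esub> v" if "u \<in> Y" "v \<in> Y" for u v
      using ZG[OF x(2)] that x(1) by (simp add: G.inv_mult_group G.m_assoc canc)
    ultimately show ?thesis using x ZG[OF x(2)] by (auto simp: Z_def)
  qed
  have L1: "L \<one>\<^bsub>G\<^esub> = (\<lambda>Y. if Y \<in> Z then Some Y else None)"
  proof
    fix Y
    have "(\<lambda>y. \<one>\<^bsub>G\<^esub> \<otimes>\<^bsub>G\<^esub> y) ` Y = Y" if "Y \<in> Z" using ZG[OF that] by force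
    then show "L \<one>\<^bsub>G\<^esub> Y = (if Y \<in> Z then Some Y else None)" by (auto simp: L_def Z_def)
  qed
  have L_carrier: "dom (L x) \<subseteq> Z" "ran (L x) \<subseteq> Z" if "x \<in> carrier G" for x
    using shift[OF that] by (auto simp: L_def dom_def ran_def split: if_splits)
  have inv_mem: "inv\<^bsub>G\<^esub> x \<in> (\<lambda>z. y \<otimes>\<^bsub>G\<^esub> z) ` Y \<longleftrightarrow> inv\<^bsub>G\<^esub> (x \<otimes>\<^bsub>G\<^esub> y) \<in> Y"
    if xy: "x \<in> carrier G" "y \<in> carrier G" "Y \<in> Z" for x y Y
  proof
    assume "inv\<^bsub>G\<^esub> x \<in> (\<lambda>z. y \<otimes>\<^bsub>G\<^esub> z) ` Y"
    then obtain z where z: "z \<in> Y" "inv\<^bsub>G\<^esub> x = y \<otimes>\<^bsub>G\<^esub> z" by auto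
    have "inv\<^bsub>G\<^esub> (x \<otimes>\<^bsub>G\<^esub> y) = inv\<^bsub>G\<^esub> y \<otimes>\<^bsub>G\<^esub> (y \<otimes>\<^bsub>G\<^esub> z)"
      using xy by (simp add: G.inv_mult_group z(2))
    also have "\<dots> = z" using xy ZG[OF xy(3) z(1)] by (simp add: G.m_assoc[symmetric])
    finally show "inv\<^bsub>G\<^esub> (x \<otimes>\<^bsub>G\<^esub> y) \<in> Y" using z(1) by simp
  next
    assume Y: "inv\<^bsub>G\<^esub> (x \<otimes>\<^bsub>G\<^esub> y) \<in> Y"
    have "inv\<^bsub>G\<^esub> x = y \<otimes>\<^bsub>G\<^esub> inv\<^bsub>G\<^esub> (x \<otimes>\<^bsub>G\<^esub> y)"
      using xy by (simp add: G.inv_mult_group G.m_assoc[symmetric])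
    then show "inv\<^bsub>G\<^esub> x \<in> (\<lambda>z. y \<otimes>\<^bsub>G\<^esub> z) ` Y" using Y by blast
  qed
  have image2: "(\<lambda>z. x \<otimes>\<^bsub>G\<^esub> z) ` (\<lambda>z. y \<otimes>\<^bsub>G\<^esub> z) ` Y = (\<lambda>z. x \<otimes>\<^bsub>G\<^esub> y \<otimes>\<^bsub>G\<^esub> z) ` Y"
    if "x \<in> carrier G" "y \<in> carrier G" "Y \<in> Z" for x y Y
    using ZG[OF that(3)] that by (force simp: G.m_assoc image_iff)
  have LL: "L x \<circ>\<^sub>m L y = (\<lambda>Y. if Y \<in> Z \<and> inv\<^bsub>G\<^esub> y \<in> Y \<and> inv\<^bsub>G\<^esub> (x \<otimes>\<^bsub>G\<^esub> y) \<in> Y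
      then Some ((\<lambda>z. x \<otimes>\<^bsub>G\<^esub> y \<otimes>\<^bsub>G\<^esub> z) ` Y) else None)"
    if "x \<in> carrier G" "y \<in> carrier G" for x y
    using that by (auto simp: fun_eq_iff map_comp_def L_def inv_mem image2 shift)
  have LLL: "L x \<circ>\<^sub>m L y \<circ>\<^sub>m L z = (\<lambda>Y. if Y \<in> Z \<and> inv\<^bsub>G\<^esub> z \<in> Y \<and> inv\<^bsub>G\<^esub> (y \<otimes>\<^bsub>G\<^esub> z) \<in> Y \<and>
      inv\<^bsub>G\<^esub> (x \<otimes>\<^bsub>G\<^esub> y \<otimes>\<^bsub>G\<^esub> z) \<in> Y then Some ((\<lambda>w. x \<otimes>\<^bsub>G\<^esub> y \<otimes>\<^bsub>G\<^esub> z \<otimes>\<^bsub>G\<^esub> w) ` Y) else None)"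
    if "x \<in> carrier G" "y \<in> carrier G" "z \<in> carrier G" for x y z
  proof
    fix Y
    have "(L x \<circ>\<^sub>m L y \<circ>\<^sub>m L z) Y = (case L z Y of None \<Rightarrow> None | Some W \<Rightarrow> (L x \<circ>\<^sub>m L y) W)"
      by (rule fun_cong[OF map_comp_def])
    then show "(L x \<circ>\<^sub>m L y \<circ>\<^sub>m L z) Y = (if Y \<in> Z \<and> inv\<^bsub>G\<^esub> z \<in> Y \<and> inv\<^bsub>G\<^esub> (y \<otimes>\<^bsub>G\<^esub> z) \<in> Y \<and>
        inv\<^bsub>G\<^esub> (x \<otimes>\<^bsub>G\<^esub> y \<otimes>\<^bsub>G\<^esub> z) \<in> Y then Some ((\<lambda>w. x \<otimes>\<^bsub>G\<^esub> y \<otimes>\<^bsub>G\<^esub> z \<otimes>\<^bsub>G\<^esub> w) ` Y) else None)"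
      using that by (auto simp: LL L_def[of z] inv_mem image2 shift)
  qed
  have assoc: "(f \<circ>\<^sub>m g) \<circ>\<^sub>m h = f \<circ>\<^sub>m (g \<circ>\<^sub>m h)" for f g h :: "'g set \<Rightarrow> 'g set option"
    by (auto simp: fun_eq_iff map_comp_def split: option.splits)
  have comp_one: "L \<one>\<^bsub>G\<^esub> \<circ>\<^sub>m f = f" "f \<circ>\<^sub>m L \<one>\<^bsub>G\<^esub> = f" if "dom f \<subseteq> Z" "ran f \<subseteq> Z" for f
    using that by (force simp: fun_eq_iff map_comp_def L1 dom_def ran_def split: option.splits)+
  have comp_X: "dom (f \<circ>\<^sub>m g) \<subseteq> Z" "ran (f \<circ>\<^sub>m g) \<subseteq> Z" if "ran f \<subseteq> Z" "dom g \<subseteq> Z"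
    for f g :: "'g set \<Rightarrow> 'g set option"
    using that by (auto simp: map_comp_def dom_def ran_def split: option.splits)
  have LL_empty: "L x \<circ>\<^sub>m L y = Map.empty \<longleftrightarrow> {x, y, x \<otimes>\<^bsub>G\<^esub> y} \<inter> S \<noteq> {}"
    if xy: "x \<in> carrier G" "y \<in> carrier G" for x y
  proof -
    have ne: "L x \<circ>\<^sub>m L y = Map.empty \<longleftrightarrow> \<not> (\<exists>Y\<in>Z. inv\<^bsub>G\<^esub> y \<in> Y \<and> inv\<^bsub>G\<^esub> (x \<otimes>\<^bsub>G\<^esub> y) \<in> Y)"
      using xy by (auto simp: LL fun_eq_iff)
    have y1: "y \<otimes>\<^bsub>G\<^esub> inv\<^bsub>G\<^esub> (x \<otimes>\<^bsub>G\<^esub> y) = inv\<^bsub>G\<^esub> x"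
      using xy by (simp add: G.inv_mult_group G.m_assoc[symmetric])
    have y2: "x \<otimes>\<^bsub>G\<^esub> y \<otimes>\<^bsub>G\<^esub> inv\<^bsub>G\<^esub> y = x" using xy by (simp add: G.m_assoc)
    have "(\<exists>Y\<in>Z. inv\<^bsub>G\<^esub> y \<in> Y \<and> inv\<^bsub>G\<^esub> (x \<otimes>\<^bsub>G\<^esub> y) \<in> Y) \<longleftrightarrow> {x, y, x \<otimes>\<^bsub>G\<^esub> y} \<inter> S = {}"
    proof
      assume "\<exists>Y\<in>Z. inv\<^bsub>G\<^esub> y \<in> Y \<and> inv\<^bsub>G\<^esub> (x \<otimes>\<^bsub>G\<^esub> y) \<in> Y"
      then obtain Y where Y: "Y \<in> Z" "inv\<^bsub>G\<^esub> y \<in> Y" "inv\<^bsub>G\<^esub> (x \<otimes>\<^bsub>G\<^esub> y) \<in> Y" by blast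
      have *: "inv\<^bsub>G\<^esub> u \<otimes>\<^bsub>G\<^esub> v \<notin> S" if "u \<in> Y" "v \<in> Y" for u v using Y(1) that by (auto simp: Z_def)
      from *[OF Z_one[OF Y(1)] Y(2)] *[OF Z_one[OF Y(1)] Y(3)] *[OF Y(2,3)] show "{x, y, x \<otimes>\<^bsub>G\<^esub> y} \<inter> S = {}"
        using xy by (simp add: y1 S_inv_iff)
    next
      assume *: "{x, y, x \<otimes>\<^bsub>G\<^esub> y} \<inter> S = {}"
      have Y: "{\<one>\<^bsub>G\<^esub>, inv\<^bsub>G\<^esub> y, inv\<^bsub>G\<^esub> (x \<otimes>\<^bsub>G\<^esub> y)} \<in> Z"
        unfolding Z_def using * xy S_one by (simp add: y1 y2 S_inv_iff)
      show "\<exists>Y\<in>Z. inv\<^bsub>G\<^esub> y \<in> Y \<and> inv\<^bsub>G\<^esub> (x \<otimes>\<^bsub>G\<^esub> y) \<in> Y"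
        by (rule bexI[OF _ Y], simp)
    qed
    then show ?thesis using ne by blast
  qed
  have L1_ne: "L \<one>\<^bsub>G\<^esub> \<noteq> Map.empty"
  proof -
    have "{\<one>\<^bsub>G\<^esub>} \<in> Z" using S_one by (auto simp: Z_def)
    then show ?thesis by (auto simp: L1 fun_eq_iff)
  qed
  have empty_comp: "Map.empty \<circ>\<^sub>m f = Map.empty" "f \<circ>\<^sub>m Map.empty = Map.empty"
    for f :: "'g set \<Rightarrow> 'g set option"
    by (auto simp: map_comp_def fun_eq_iff split: option.splits)
  have PP: "P c f \<otimes>\<^bsub>M\<^esub> P d g = P (c \<otimes>\<^bsub>K\<^esub> d) (f \<circ>\<^sub>m g)" for c d f g
    by (auto simp: M_def P_def empty_comp)
  have kzP: "kzero M \<otimes>\<^bsub>M\<^esub> P c f = kzero M" "P c f \<otimes>\<^bsub>M\<^esub> kzero M = kzero M" for c f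
    by (auto simp: M_def P_def empty_comp)
  have P_zero: "P \<one>\<^bsub>K\<^esub> f = kzero M \<longleftrightarrow> f = Map.empty" for f by (auto simp: M_def P_def)
  have M_carrierE: "\<exists>c f. p = P c f \<and> c \<in> carrier K \<and> c \<noteq> \<zero>\<^bsub>K\<^esub> \<and> dom f \<subseteq> Z \<and> ran f \<subseteq> Z"
    if "p \<in> carrier M" for p
  proof (cases "snd p = Map.empty")
    case True
    then have "p = P \<one>\<^bsub>K\<^esub> Map.empty" using that by (auto simp: M_def P_def)
    then show ?thesis by force
  next
    case False
    then show ?thesis using that by (intro exI[of _ "fst p"] exI[of _ "snd p"]) (auto simp: M_def P_def)
  qed
  have P_M: "P c f \<in> carrier M" if "c \<in> carrier K" "c \<noteq> \<zero>\<^bsub>K\<^esub>" "dom f \<subseteq> Z" "ran f \<subseteq> Z" for c f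
    using that by (auto simp: M_def P_def)
  have oneM: "\<one>\<^bsub>M\<^esub> = P \<one>\<^bsub>K\<^esub> (L \<one>\<^bsub>G\<^esub>)" using L1_ne by (simp add: M_def P_def)
  have scale: "kscale M a (P c f) = (if a = \<zero>\<^bsub>K\<^esub> then kzero M else P (a \<otimes>\<^bsub>K\<^esub> c) f)"
    if "a \<in> carrier K" for a c f
    using that by (auto simp: M_def P_def)
  have scale0: "kscale M a (kzero M) = kzero M" if "a \<in> carrier K" for a
    using that by (auto simp: M_def)
  have M: "cancellative_kmonoid K M"
  proof unfold_locales
    fix p q assume "p \<in> carrier M" "q \<in> carrier M"
    then obtain c f d g where *: "p = P c f" "c \<in> carrier K" "c \<noteq> \<zero>\<^bsub>K\<^esub>" "ran f \<subseteq> Z"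
      "q = P d g" "d \<in> carrier K" "d \<noteq> \<zero>\<^bsub>K\<^esub>" "dom g \<subseteq> Z"
      using M_carrierE[of p] M_carrierE[of q] by metis
    then show "p \<otimes>\<^bsub>M\<^esub> q \<in> carrier M"
      using comp_X[of f g] by (simp add: PP P_M K.integral_iff)
  next
    fix p q r assume "p \<in> carrier M" "q \<in> carrier M" "r \<in> carrier M"
    then show "p \<otimes>\<^bsub>M\<^esub> q \<otimes>\<^bsub>M\<^esub> r = p \<otimes>\<^bsub>M\<^esub> (q \<otimes>\<^bsub>M\<^esub> r)"
      by (auto dest!: M_carrierE simp: PP assoc K.m_assoc)
  next
    show "\<one>\<^bsub>M\<^esub> \<in> carrier M" by (simp add: oneM P_M L_carrier)
  next
    fix p assume "p \<in> carrier M"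
    then show "\<one>\<^bsub>M\<^esub> \<otimes>\<^bsub>M\<^esub> p = p" "p \<otimes>\<^bsub>M\<^esub> \<one>\<^bsub>M\<^esub> = p"
      by (auto dest!: M_carrierE simp: oneM PP comp_one)
  next
    show "kzero M \<in> carrier M" by (simp add: M_def)
  next
    fix p assume "p \<in> carrier M"
    then show "kzero M \<otimes>\<^bsub>M\<^esub> p = kzero M" "p \<otimes>\<^bsub>M\<^esub> kzero M = kzero M"
      by (auto simp: M_def P_def empty_comp)
  next
    fix a p assume "a \<in> carrier K" "p \<in> carrier M"
    then show "kscale M a p \<in> carrier M"
      by (auto simp: M_def K.integral_iff split: if_splits)
  next
    fix p assume "p \<in> carrier M"
    then show "kscale M \<one>\<^bsub>K\<^esub> p = p" "kscale M \<zero>\<^bsub>K\<^esub> p = kzero M"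
      by (auto simp: M_def)
  next
    fix a b p assume "a \<in> carrier K" "b \<in> carrier K" "p \<in> carrier M"
    then show "kscale M a (kscale M b p) = kscale M (a \<otimes>\<^bsub>K\<^esub> b) p"
      by (auto dest!: M_carrierE simp: scale scale0 K.m_assoc K.integral_iff)
  next
    fix a p q assume "a \<in> carrier K" "p \<in> carrier M" "q \<in> carrier M"
    then show "kscale M a (p \<otimes>\<^bsub>M\<^esub> q) = kscale M a p \<otimes>\<^bsub>M\<^esub> q"
      "kscale M a (p \<otimes>\<^bsub>M\<^esub> q) = p \<otimes>\<^bsub>M\<^esub> kscale M a q"
      by (auto dest!: M_carrierE simp: scale PP kzP K.m_assoc K.m_lcomm)
  next
    fix a b p assume "a \<in> carrier K" "b \<in> carrier K" "p \<in> carrier M" "p \<noteq> kzero M"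
      "kscale M a p = kscale M b p"
    then show "a = b"
      by (auto simp: M_def K.m_rcancel split: if_splits)
  qed
  have "proj_rep_with_factor_set K G M (\<lambda>x. P \<one>\<^bsub>K\<^esub> (L x)) (diag_factor_set K G S)"
    unfolding proj_rep_with_factor_set_def
  proof (intro conjI ballI impI)
    show "(\<lambda>x. P \<one>\<^bsub>K\<^esub> (L x)) \<in> carrier G \<rightarrow> carrier M" using L_carrier by (auto intro!: P_M)
    show "diag_factor_set K G S \<in> carrier G \<times> carrier G \<rightarrow>\<^sub>E carrier K"
      by (auto simp: diag_factor_set_def)
  next
    fix x y assume xy: "x \<in> carrier G" "y \<in> carrier G"
    have x1: "inv\<^bsub>G\<^esub> x \<otimes>\<^bsub>G\<^esub> (x \<otimes>\<^bsub>G\<^esub> y) = y" and x2: "x \<otimes>\<^bsub>G\<^esub> y \<otimes>\<^bsub>G\<^esub> inv\<^bsub>G\<^esub> y = x"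
      using xy by (simp add: G.m_assoc[symmetric]) (use xy in \<open>simp add: G.m_assoc\<close>)
    show "P \<one>\<^bsub>K\<^esub> (L (inv\<^bsub>G\<^esub> x)) \<otimes>\<^bsub>M\<^esub> P \<one>\<^bsub>K\<^esub> (L (x \<otimes>\<^bsub>G\<^esub> y)) = kzero M \<longleftrightarrow>
        P \<one>\<^bsub>K\<^esub> (L x) \<otimes>\<^bsub>M\<^esub> P \<one>\<^bsub>K\<^esub> (L y) = kzero M"
      using xy by (auto simp: PP P_zero LL_empty S_inv_iff x1)
    show "P \<one>\<^bsub>K\<^esub> (L (x \<otimes>\<^bsub>G\<^esub> y)) \<otimes>\<^bsub>M\<^esub> P \<one>\<^bsub>K\<^esub> (L (inv\<^bsub>G\<^esub> y)) = kzero M \<longleftrightarrow>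
        P \<one>\<^bsub>K\<^esub> (L x) \<otimes>\<^bsub>M\<^esub> P \<one>\<^bsub>K\<^esub> (L y) = kzero M"
      using xy by (auto simp: PP P_zero LL_empty S_inv_iff x2)
    show "diag_factor_set K G S (x, y) = \<zero>\<^bsub>K\<^esub> \<longleftrightarrow> P \<one>\<^bsub>K\<^esub> (L x) \<otimes>\<^bsub>M\<^esub> P \<one>\<^bsub>K\<^esub> (L y) = kzero M"
      using xy by (auto simp: PP P_zero LL_empty diag_factor_set_def)
    assume "P \<one>\<^bsub>K\<^esub> (L x) \<otimes>\<^bsub>M\<^esub> P \<one>\<^bsub>K\<^esub> (L y) \<noteq> kzero M"
    then have \<sigma>: "diag_factor_set K G S (x, y) = \<one>\<^bsub>K\<^esub>"
      using xy by (auto simp: PP P_zero LL_empty diag_factor_set_def)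
    have "L (inv\<^bsub>G\<^esub> x) \<circ>\<^sub>m L x \<circ>\<^sub>m L y = L (inv\<^bsub>G\<^esub> x) \<circ>\<^sub>m L (x \<otimes>\<^bsub>G\<^esub> y)"
      unfolding LLL[OF G.inv_closed[OF xy(1)] xy] LL[OF G.inv_closed[OF xy(1)] G.m_closed[OF xy]]
      by (rule ext) (simp add: x1 xy conj_ac)
    then show "P \<one>\<^bsub>K\<^esub> (L (inv\<^bsub>G\<^esub> x)) \<otimes>\<^bsub>M\<^esub> P \<one>\<^bsub>K\<^esub> (L x) \<otimes>\<^bsub>M\<^esub> P \<one>\<^bsub>K\<^esub> (L y) =
        kscale M (diag_factor_set K G S (x, y))
          (P \<one>\<^bsub>K\<^esub> (L (inv\<^bsub>G\<^esub> x)) \<otimes>\<^bsub>M\<^esub> P \<one>\<^bsub>K\<^esub> (L (x \<otimes>\<^bsub>G\<^esub> y)))"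
      by (simp add: PP \<sigma> scale)
    have "L x \<circ>\<^sub>m L y \<circ>\<^sub>m L (inv\<^bsub>G\<^esub> y) = L (x \<otimes>\<^bsub>G\<^esub> y) \<circ>\<^sub>m L (inv\<^bsub>G\<^esub> y)"
      unfolding LLL[OF xy G.inv_closed[OF xy(2)]] LL[OF G.m_closed[OF xy] G.inv_closed[OF xy(2)]]
      by (rule ext) (simp add: x2 xy Z_one conj_ac cong: conj_cong)
    then show "P \<one>\<^bsub>K\<^esub> (L x) \<otimes>\<^bsub>M\<^esub> P \<one>\<^bsub>K\<^esub> (L y) \<otimes>\<^bsub>M\<^esub> P \<one>\<^bsub>K\<^esub> (L (inv\<^bsub>G\<^esub> y)) =
        kscale M (diag_factor_set K G S (x, y))
          (P \<one>\<^bsub>K\<^esub> (L (x \<otimes>\<^bsub>G\<^esub> y)) \<otimes>\<^bsub>M\<^esub> P \<one>\<^bsub>K\<^esub> (L (inv\<^bsub>G\<^esub> y)))"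
      by (simp add: PP \<sigma> scale)
  qed (simp_all add: M oneM)
  then show ?thesis by (rule pm_memI[OF G])
qed

lemma carrier_pm_diag:
  assumes "field K" "group G"
  shows "carrier (pm_diag K G) = {diag_factor_set K G S |S. diag_support G S}"
  using diag_factor_set_mem_pm[OF assms] by (auto simp: pm_diag_def)

lemma pm_diag_closed:
  assumes K: "field K" and G: "group G"
    and \<sigma>: "\<sigma> \<in> carrier (pm_diag K G)" and \<tau>: "\<tau> \<in> carrier (pm_diag K G)"
  shows "\<sigma> \<otimes>\<^bsub>pm_diag K G\<^esub> \<tau> \<in> carrier (pm_diag K G)"
proof -
  interpret K: field K by (rule K)
  obtain S T where ST: "diag_support G S" "diag_support G T"
    "\<sigma> = diag_factor_set K G S" "\<tau> = diag_factor_set K G T"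
    using \<sigma> \<tau> by (auto simp: carrier_pm_diag[OF K G])
  have "\<sigma> \<otimes>\<^bsub>pm_diag K G\<^esub> \<tau> = diag_factor_set K G (S \<union> T)"
    by (auto simp: ST pm_diag_def pm_def diag_factor_set_def fun_eq_iff restrict_def)
  moreover have "diag_support G (S \<union> T)" using ST by (auto simp: diag_support_def)
  ultimately show ?thesis by (auto simp: carrier_pm_diag[OF K G])
qed


section \<open>The infinite dihedral group by its presentation\<close>

text \<open>A letter \<open>(a, False)\<close> stands for the generator \<open>a\<close>, and \<open>(a, True)\<close> for its inverse.\<close>

type_synonym 'a word = "('a \<times> bool) list"

inductive pres_eq :: "('a word \<times> 'a word) set \<Rightarrow> 'a word \<Rightarrow> 'a word \<Rightarrow> bool"
  for R :: "('a word \<times> 'a word) set" where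
  refl: "pres_eq R u u"
| sym: "pres_eq R u v \<Longrightarrow> pres_eq R v u"
| trans: "pres_eq R u v \<Longrightarrow> pres_eq R v w \<Longrightarrow> pres_eq R u w"
| cancel: "pres_eq R (u @ [(a, e), (a, \<not> e)] @ v) (u @ v)"
| relator: "(r, s) \<in> R \<Longrightarrow> pres_eq R (u @ r @ v) (u @ s @ v)"

definition pres_class :: "('a word \<times> 'a word) set \<Rightarrow> 'a word \<Rightarrow> 'a word set" where
  "pres_class R u = {v. pres_eq R u v}"

text \<open>The generators are all elements of the type \<open>'a\<close>.\<close>

definition presented_group :: "('a word \<times> 'a word) set \<Rightarrow> 'a word set monoid" where
  "presented_group R =
     \<lparr>carrier = range (pres_class R),
      monoid.mult = (\<lambda>U V. {w. \<exists>u\<in>U. \<exists>v\<in>V. pres_eq R (u @ v) w}),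
      one = pres_class R []\<rparr>"

datatype dihedral_gen = Gen_a | Gen_b

definition D_inf :: "dihedral_gen word set monoid" where
  "D_inf = presented_group
     {([(Gen_b, False), (Gen_b, False)], []),
      ([(Gen_b, False), (Gen_a, False)], [(Gen_a, True), (Gen_b, False)])}"

lemma pres_eq_append_left: "pres_eq R u v \<Longrightarrow> pres_eq R (w @ u) (w @ v)"
proof (induction rule: pres_eq.induct)
  case (cancel u a e v)
  show ?case using pres_eq.cancel[of R "w @ u" a e v] by simp
next
  case (relator r s u v)
  then show ?case using pres_eq.relator[of r s R "w @ u" v] by simp
qed (auto intro: pres_eq.refl pres_eq.sym pres_eq.trans)

lemma pres_eq_append_right: "pres_eq R u v \<Longrightarrow> pres_eq R (u @ w) (v @ w)"
proof (induction rule: pres_eq.induct)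
  case (cancel u a e v)
  show ?case using pres_eq.cancel[of R u a e "v @ w"] by simp
next
  case (relator r s u v)
  then show ?case using pres_eq.relator[of r s R u "v @ w"] by simp
qed (auto intro: pres_eq.refl pres_eq.sym pres_eq.trans)

lemma pres_eq_append:
  "pres_eq R u u' \<Longrightarrow> pres_eq R v v' \<Longrightarrow> pres_eq R (u @ v) (u' @ v')"
  by (meson pres_eq.trans pres_eq_append_left pres_eq_append_right)

lemma pres_class_eq_iff: "pres_class R u = pres_class R v \<longleftrightarrow> pres_eq R u v"
  unfolding pres_class_def set_eq_iff mem_Collect_eq
  by (meson pres_eq.refl pres_eq.sym pres_eq.trans)

lemma carrier_presented_group: "carrier (presented_group R) = range (pres_class R)"
  by (simp add: presented_group_def)

lemma one_presented_group: "\<one>\<^bsub>presented_group R\<^esub> = pres_class R []"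
  by (simp add: presented_group_def)

lemma presented_group_mult:
  "pres_class R u \<otimes>\<^bsub>presented_group R\<^esub> pres_class R v = pres_class R (u @ v)"
proof (rule equalityI; rule subsetI)
  fix w assume "w \<in> pres_class R u \<otimes>\<^bsub>presented_group R\<^esub> pres_class R v"
  then obtain u' v' where *: "pres_eq R u u'" "pres_eq R v v'" "pres_eq R (u' @ v') w"
    by (auto simp: presented_group_def pres_class_def)
  then show "w \<in> pres_class R (u @ v)"
    using pres_eq.trans[OF pres_eq_append[OF *(1,2)] *(3)] by (simp add: pres_class_def)
next
  fix w assume "w \<in> pres_class R (u @ v)"
  moreover have "pres_eq R u u" "pres_eq R v v" by (rule pres_eq.refl)+
  ultimately show "w \<in> pres_class R u \<otimes>\<^bsub>presented_group R\<^esub> pres_class R v"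
    unfolding presented_group_def pres_class_def by simp blast
qed

lemma presented_group_inverse:
  "pres_eq R (map (\<lambda>(a, e). (a, \<not> e)) (rev u) @ u) []"
proof (induction u)
  case Nil
  show ?case by (simp add: pres_eq.refl)
next
  case (Cons l u)
  obtain a e where l: "l = (a, e)" by fastforce
  show ?case
    using pres_eq.trans[OF pres_eq.cancel[of R "map (\<lambda>(a, e). (a, \<not> e)) (rev u)" a "\<not> e" u] Cons]
    by (simp add: l)
qed

lemma group_presented_group: "group (presented_group R)"
proof (rule groupI)
  fix x assume "x \<in> carrier (presented_group R)"
  then obtain u where u: "x = pres_class R u" by (auto simp: carrier_presented_group)
  show "\<exists>y\<in>carrier (presented_group R). y \<otimes>\<^bsub>presented_group R\<^esub> x = \<one>\<^bsub>presented_group R\<^esub>"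
    by (rule bexI[of _ "pres_class R (map (\<lambda>(a, e). (a, \<not> e)) (rev u))"])
      (simp_all add: u rangeI carrier_presented_group one_presented_group presented_group_mult
        pres_class_eq_iff presented_group_inverse)
qed (auto simp: carrier_presented_group one_presented_group presented_group_mult)

lemma group_D_inf: "group D_inf"
  unfolding D_inf_def by (rule group_presented_group)

end

theory Submission
  imports Defs
begin

text \<open>
  A diagonal factor set is determined by its support \<open>S\<close>, and products correspond to unions of
  supports. The supports are the unions of orbits of \<open>g \<mapsto> g\<inverse>\<close> on the non-identity elements, so
  the semigroup is \<open>{0,1}\<^bsup>I\<^esup>\<close> for any set \<open>I\<close> indexing these orbits. In \<open>D\<^sub>\<infinity>\<close> the orbits are
  \<open>{a\<^sup>n, a\<^bsup>-n\<^esup>}\<close> for \<open>n > 0\<close> and the singletons \<open>{a\<^sup>k b}\<close> for \<open>k \<in> \<int>\<close>; that these are distinct is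
  read off from the action of \<open>D\<^sub>\<infinity>\<close> on \<open>\<int>\<close> by \<open>a k = k + 1\<close> and \<open>b k = -k\<close>.
\<close>

section \<open>Diagonal factor sets of an arbitrary group\<close>

text \<open>For \<open>y = 1\<close> the tested set is \<open>{g, 1}\<close>, and \<open>1\<close>
  lies outside \<open>S\<close>. Hence a diagonal factor set determines its support.\<close>

lemma diag_factor_set_one_right:
  assumes "group G" "diag_support G S" "g \<in> carrier G"
  shows "diag_factor_set K G S (g, \<one>\<^bsub>G\<^esub>) = (if g \<in> S then \<zero>\<^bsub>K\<^esub> else \<one>\<^bsub>K\<^esub>)"
proof -
  interpret group G by (rule assms(1))
  show ?thesis using assms(2,3) by (auto simp: diag_factor_set_def diag_support_def)
qed

text \<open>\<open>r\<close> picks one element from each inversion orbit of non-identity elements: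
  \<open>covers\<close> reaches every orbit, \<open>separates\<close> forbids repetition.\<close>

lemma pm_diag_iso_zero_one_functions:
  fixes K :: "('k, 'c) ring_scheme" and G :: "('g, 'b) monoid_scheme" and r :: "'i \<Rightarrow> 'g"
  assumes K: "field K" and G: "group G"
    and r: "\<And>i. i \<in> I \<Longrightarrow> r i \<in> carrier G" "\<And>i. i \<in> I \<Longrightarrow> r i \<noteq> \<one>\<^bsub>G\<^esub>"
    and covers: "\<And>g. g \<in> carrier G \<Longrightarrow> g \<noteq> \<one>\<^bsub>G\<^esub> \<Longrightarrow> \<exists>i\<in>I. g = r i \<or> g = inv\<^bsub>G\<^esub> (r i)"
    and separates: "\<And>i j. i \<in> I \<Longrightarrow> j \<in> I \<Longrightarrow> r i = r j \<or> r i = inv\<^bsub>G\<^esub> (r j) \<Longrightarrow> i = j"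
  shows "pm_diag K G \<cong> zero_one_functions I"
proof -
  interpret K: field K by (rule K)
  interpret G: group G by (rule G)
  \<comment> \<open>Reading the values at \<open>(r i, 1)\<close> avoids choosing a support. The
    value 0 marks \<open>r i\<close> in \<open>S\<close>, so pointwise products match unions of
    supports.\<close>
  define h :: "('g \<times> 'g \<Rightarrow> 'k) \<Rightarrow> 'i \<Rightarrow> nat"
    where "h \<sigma> = (\<lambda>i\<in>I. if \<sigma> (r i, \<one>\<^bsub>G\<^esub>) = \<zero>\<^bsub>K\<^esub> then 0 else 1)" for \<sigma>
  have h_diag: "h (diag_factor_set K G S) = (\<lambda>i\<in>I. if r i \<in> S then 0 else 1)"
    if "diag_support G S" for S
    using that r(1) by (auto simp: h_def fun_eq_iff restrict_def diag_factor_set_one_right[OF G])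
  have "h \<in> hom (pm_diag K G) (zero_one_functions I)"
  proof (rule homI)
    fix \<sigma> assume "\<sigma> \<in> carrier (pm_diag K G)"
    then show "h \<sigma> \<in> carrier (zero_one_functions I)"
      by (auto simp: h_def zero_one_functions_def)
  next
    fix \<sigma> \<tau> assume "\<sigma> \<in> carrier (pm_diag K G)" "\<tau> \<in> carrier (pm_diag K G)"
    then obtain S T where ST: "diag_support G S" "diag_support G T"
      "\<sigma> = diag_factor_set K G S" "\<tau> = diag_factor_set K G T"
      by (auto simp: carrier_pm_diag[OF K G])
    show "h (\<sigma> \<otimes>\<^bsub>pm_diag K G\<^esub> \<tau>) = h \<sigma> \<otimes>\<^bsub>zero_one_functions I\<^esub> h \<tau>"
      using ST(1,2) r(1)
      by (auto simp: ST(3,4) h_def zero_one_functions_def pm_diag_def pm_def fun_eq_iff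
          restrict_def diag_factor_set_one_right[OF G])
  qed
  moreover have "bij_betw h (carrier (pm_diag K G)) (carrier (zero_one_functions I))"
  proof (rule bij_betwI')
    fix \<sigma> \<tau> assume "\<sigma> \<in> carrier (pm_diag K G)" "\<tau> \<in> carrier (pm_diag K G)"
    then obtain S T where ST: "diag_support G S" "diag_support G T"
      "\<sigma> = diag_factor_set K G S" "\<tau> = diag_factor_set K G T"
      by (auto simp: carrier_pm_diag[OF K G])
    have inv_iff: "inv\<^bsub>G\<^esub> g \<in> U \<longleftrightarrow> g \<in> U" if "diag_support G U" "g \<in> carrier G" for g U
      using that by (metis G.inv_inv diag_support_def)
    have "S = T" if "h \<sigma> = h \<tau>"
    proof -
      have *: "r i \<in> S \<longleftrightarrow> r i \<in> T" if "i \<in> I" for i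
        using fun_cong[OF \<open>h \<sigma> = h \<tau>\<close>, of i] that
        by (simp add: ST(3,4) h_diag ST(1,2) split: if_splits)
      have "g \<in> S \<longleftrightarrow> g \<in> T" if g: "g \<in> carrier G" "g \<noteq> \<one>\<^bsub>G\<^esub>" for g
        using covers[OF g] * inv_iff ST(1,2) r(1) by metis
      then show ?thesis using ST(1,2) by (auto simp: diag_support_def)
    qed
    then show "h \<sigma> = h \<tau> \<longleftrightarrow> \<sigma> = \<tau>" using ST by blast
  next
    fix \<sigma> assume "\<sigma> \<in> carrier (pm_diag K G)"
    then show "h \<sigma> \<in> carrier (zero_one_functions I)"
      by (auto simp: h_def zero_one_functions_def)
  next
    fix f assume "f \<in> carrier (zero_one_functions I)"
    then have f: "f \<in> I \<rightarrow>\<^sub>E {0, 1}" by (simp add: zero_one_functions_def)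
    \<comment> \<open>The union of the orbits on which \<open>f\<close> vanishes. By
      \<open>separates\<close>, no \<open>r i\<close> with \<open>f i = 1\<close> falls into
      it.\<close>
    define S where "S = {g. \<exists>i\<in>I. f i = 0 \<and> (g = r i \<or> g = inv\<^bsub>G\<^esub> (r i))}"
    have S: "diag_support G S"
      using r by (auto simp: S_def diag_support_def) (metis G.inv_eq_1_iff)+
    have "r i \<in> S \<longleftrightarrow> f i = 0" if "i \<in> I" for i
      using that separates by (auto simp: S_def)
    then have "f = h (diag_factor_set K G S)"
      using f PiE_mem[OF f] by (fastforce simp: h_diag[OF S] fun_eq_iff restrict_def PiE_arb[OF f])
    with S show "\<exists>\<sigma>\<in>carrier (pm_diag K G). f = h \<sigma>"
      by (auto simp: carrier_pm_diag[OF K G])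
  qed
  ultimately show ?thesis by (auto simp: is_iso_def iso_def)
qed

section \<open>Relations and normal forms in \<open>D_inf\<close>\<close>

lemma (in group) int_pow_inverted_by:
  fixes n :: int
  assumes [simp]: "x \<in> carrier G" "y \<in> carrier G" and yx: "y \<otimes> x = inv x \<otimes> y"
  shows "y \<otimes> x [^] n = x [^] (- n) \<otimes> y"
proof -
  \<comment> \<open>The downward induction needs the relation for \<open>inv x\<close>: multiply
    \<open>yx\<close> by \<open>x\<close> on the left and by \<open>inv x\<close> on the
    right.\<close>
  have yx': "y \<otimes> inv x = x \<otimes> y"
    by (metis assms inv_closed inv_solve_left inv_solve_right m_assoc m_closed)
  show ?thesis
  proof (induction n rule: int_induct[where k = 0])
    case (step1 i)
    have "y \<otimes> x [^] (i + 1) = y \<otimes> x [^] i \<otimes> x"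
      by (simp add: int_pow_mult m_assoc)
    also have "\<dots> = x [^] (- i) \<otimes> inv x \<otimes> y"
      by (simp add: step1 m_assoc yx)
    also have "\<dots> = x [^] (- (i + 1)) \<otimes> y"
      using int_pow_mult[of x "- i" "-1"] by (simp add: int_pow_neg)
    finally show ?case .
  next
    case (step2 i)
    have "y \<otimes> x [^] (i - 1) = y \<otimes> x [^] i \<otimes> inv x"
      using int_pow_mult[of x i "-1"] by (simp add: int_pow_neg m_assoc)
    also have "\<dots> = x [^] (- i) \<otimes> x \<otimes> y"
      by (simp add: step2 m_assoc yx')
    also have "\<dots> = x [^] (- (i - 1)) \<otimes> y"
      using int_pow_mult[of x "- i" 1] by (simp add: add.commute)
    finally show ?case .
  qed simp
qed

abbreviation dihedral_relators :: "(dihedral_gen word \<times> dihedral_gen word) set" where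
  "dihedral_relators \<equiv>
     {([(Gen_b, False), (Gen_b, False)], []),
      ([(Gen_b, False), (Gen_a, False)], [(Gen_a, True), (Gen_b, False)])}"

abbreviation D_a :: "dihedral_gen word set" where
  "D_a \<equiv> pres_class dihedral_relators [(Gen_a, False)]"

abbreviation D_b :: "dihedral_gen word set" where
  "D_b \<equiv> pres_class dihedral_relators [(Gen_b, False)]"

interpretation D: group D_inf by (rule group_D_inf)

lemma carrier_D_inf: "carrier D_inf = range (pres_class dihedral_relators)"
  by (simp add: D_inf_def carrier_presented_group)

lemma one_D_inf: "\<one>\<^bsub>D_inf\<^esub> = pres_class dihedral_relators []"
  by (simp add: D_inf_def one_presented_group)

lemma mult_D_inf:
  "pres_class dihedral_relators u \<otimes>\<^bsub>D_inf\<^esub> pres_class dihedral_relators v =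
   pres_class dihedral_relators (u @ v)"
  by (simp only: D_inf_def presented_group_mult)

lemma pres_class_D_inf [simp]: "pres_class dihedral_relators u \<in> carrier D_inf"
  by (simp add: carrier_D_inf)

lemma D_b_D_b: "D_b \<otimes>\<^bsub>D_inf\<^esub> D_b = \<one>\<^bsub>D_inf\<^esub>"
  using pres_eq.relator[of "[(Gen_b, False), (Gen_b, False)]" "[]" dihedral_relators "[]" "[]"]
  by (simp add: one_D_inf mult_D_inf pres_class_eq_iff)

lemma inv_D_b: "inv\<^bsub>D_inf\<^esub> D_b = D_b"
  by (simp add: D.inv_equality D_b_D_b)

lemma pres_class_inverse_letter:
  "pres_class dihedral_relators [(x, True)] =
   inv\<^bsub>D_inf\<^esub> (pres_class dihedral_relators [(x, False)])"
  using pres_eq.cancel[of dihedral_relators "[]" x True "[]"]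
  by (intro D.inv_equality[symmetric])
    (simp_all add: one_D_inf mult_D_inf pres_class_eq_iff)

lemma D_b_D_a: "D_b \<otimes>\<^bsub>D_inf\<^esub> D_a = inv\<^bsub>D_inf\<^esub> D_a \<otimes>\<^bsub>D_inf\<^esub> D_b"
  using pres_eq.relator[of "[(Gen_b, False), (Gen_a, False)]" "[(Gen_a, True), (Gen_b, False)]"
      dihedral_relators "[]" "[]"]
  by (simp add: pres_class_inverse_letter[symmetric] mult_D_inf pres_class_eq_iff)

lemma D_b_pow_D_a:
  fixes n :: int
  shows "D_b \<otimes>\<^bsub>D_inf\<^esub> D_a [^]\<^bsub>D_inf\<^esub> n = D_a [^]\<^bsub>D_inf\<^esub> (- n) \<otimes>\<^bsub>D_inf\<^esub> D_b"
  by (rule D.int_pow_inverted_by) (simp_all add: D_b_D_a)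

text \<open>A word is built by prepending letters. Left multiplication by powers of
  \<open>D_a\<close> adds exponents; by \<open>D_b\<close> it negates the exponent and toggles the
  final \<open>D_b\<close>.\<close>

lemma D_inf_normal_form:
  assumes "g \<in> carrier D_inf"
  obtains n :: int where "g = D_a [^]\<^bsub>D_inf\<^esub> n"
  | n :: int where "g = D_a [^]\<^bsub>D_inf\<^esub> n \<otimes>\<^bsub>D_inf\<^esub> D_b"
proof -
  let ?NF = "\<lambda>g. \<exists>n::int. g = D_a [^]\<^bsub>D_inf\<^esub> n \<or> g = D_a [^]\<^bsub>D_inf\<^esub> n \<otimes>\<^bsub>D_inf\<^esub> D_b"
  have pow: "?NF (D_a [^]\<^bsub>D_inf\<^esub> m \<otimes>\<^bsub>D_inf\<^esub> g)" if "?NF g" for g and m :: int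
  proof -
    from that obtain n :: int
      where "g = D_a [^]\<^bsub>D_inf\<^esub> n \<or> g = D_a [^]\<^bsub>D_inf\<^esub> n \<otimes>\<^bsub>D_inf\<^esub> D_b" by blast
    then show ?thesis
      by (intro exI[of _ "m + n"]) (auto simp: D.int_pow_mult D.m_assoc)
  qed
  have b: "?NF (D_b \<otimes>\<^bsub>D_inf\<^esub> g)" if "?NF g" for g
  proof -
    from that obtain n :: int
      where "g = D_a [^]\<^bsub>D_inf\<^esub> n \<or> g = D_a [^]\<^bsub>D_inf\<^esub> n \<otimes>\<^bsub>D_inf\<^esub> D_b" by blast
    moreover have "D_b \<otimes>\<^bsub>D_inf\<^esub> (D_a [^]\<^bsub>D_inf\<^esub> n \<otimes>\<^bsub>D_inf\<^esub> D_b) = D_a [^]\<^bsub>D_inf\<^esub> (- n)"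
      by (simp add: D.m_assoc[symmetric] D_b_pow_D_a) (simp add: D.m_assoc D_b_D_b)
    ultimately show ?thesis
      using D_b_pow_D_a by (intro exI[of _ "- n"]) auto
  qed
  have "?NF (pres_class dihedral_relators u)" for u
  proof (induction u)
    case Nil
    show ?case by (metis int_pow_0 one_D_inf)
  next
    case (Cons l u)
    have eq: "pres_class dihedral_relators (l # u) =
        pres_class dihedral_relators [l] \<otimes>\<^bsub>D_inf\<^esub> pres_class dihedral_relators u"
      by (simp add: mult_D_inf)
    have a: "D_a = D_a [^]\<^bsub>D_inf\<^esub> (1::int)" "inv\<^bsub>D_inf\<^esub> D_a = D_a [^]\<^bsub>D_inf\<^esub> (-1::int)"
      by (simp_all add: D.int_pow_neg)
    \<comment> \<open>Four letters give three cases, since \<open>D_b\<close> is its own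
      inverse.\<close>
    obtain x e where "l = (x, e)" by fastforce
    then have "pres_class dihedral_relators [l] = D_a [^]\<^bsub>D_inf\<^esub> (1::int) \<or>
        pres_class dihedral_relators [l] = D_a [^]\<^bsub>D_inf\<^esub> (-1::int) \<or>
        pres_class dihedral_relators [l] = D_b"
      unfolding a[symmetric] using inv_D_b pres_class_inverse_letter by (cases x; cases e) force+
    then show ?case
      unfolding eq using pow[OF Cons, of 1] pow[OF Cons, of "-1"] b[OF Cons] by metis
  qed
  then show thesis using assms that by (auto simp: carrier_D_inf)
qed

section \<open>The action on the integers\<close>

fun letter_act :: "dihedral_gen \<times> bool \<Rightarrow> int \<Rightarrow> int" where
  "letter_act (Gen_a, e) k = (if e then k - 1 else k + 1)"
| "letter_act (Gen_b, e) k = - k"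

text \<open>Opposite letters act as mutually inverse maps, and the relators hold because
  \<open>-(-k) = k\<close> and \<open>-(k + 1) = -k - 1\<close>.\<close>

lemma foldr_letter_act_pres_eq:
  "pres_eq dihedral_relators u v \<Longrightarrow> foldr letter_act u = foldr letter_act v"
proof (induction rule: pres_eq.induct)
  case (cancel u a e v)
  have "letter_act (a, e) (letter_act (a, \<not> e) k) = k" for k by (cases a) auto
  then show ?case by (simp add: fun_eq_iff)
qed (auto simp: fun_eq_iff)

text \<open>Any representative would do, since equivalent words act alike.\<close>

definition D_act :: "dihedral_gen word set \<Rightarrow> int \<Rightarrow> int" where
  "D_act U = foldr letter_act (SOME u. u \<in> U)"

lemma D_act_pres_class: "D_act (pres_class dihedral_relators u) = foldr letter_act u"
proof -
  have "(SOME v. v \<in> pres_class dihedral_relators u) \<in> pres_class dihedral_relators u"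
    by (rule someI[of _ u]) (simp add: pres_class_def pres_eq.refl)
  then show ?thesis
    unfolding D_act_def by (metis foldr_letter_act_pres_eq mem_Collect_eq pres_class_def)
qed

lemma D_act_mult:
  "g \<in> carrier D_inf \<Longrightarrow> h \<in> carrier D_inf \<Longrightarrow> D_act (g \<otimes>\<^bsub>D_inf\<^esub> h) k = D_act g (D_act h k)"
  by (auto simp: carrier_D_inf mult_D_inf D_act_pres_class)

lemma D_act_pow_D_a: "D_act (D_a [^]\<^bsub>D_inf\<^esub> (n::int)) k = k + n"
proof (induction n arbitrary: k rule: int_induct[where k = 0])
  case base
  show ?case by (simp add: one_D_inf D_act_pres_class)
next
  case (step1 i)
  then show ?case by (simp add: D.int_pow_mult D_act_mult D_act_pres_class)
next
  case (step2 i)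
  have "D_a [^]\<^bsub>D_inf\<^esub> (i - 1) = D_a [^]\<^bsub>D_inf\<^esub> i \<otimes>\<^bsub>D_inf\<^esub> inv\<^bsub>D_inf\<^esub> D_a"
    using D.int_pow_mult[of D_a i "-1"] by (simp add: D.int_pow_neg)
  then show ?case
    using step2
    by (simp add: D_act_mult pres_class_inverse_letter[symmetric] D_act_pres_class)
qed

lemma D_act_pow_D_a_D_b:
  "D_act (D_a [^]\<^bsub>D_inf\<^esub> (n::int) \<otimes>\<^bsub>D_inf\<^esub> D_b) k = n - k"
  by (simp add: D_act_mult D_act_pow_D_a) (simp add: D_act_pres_class)

lemma pow_D_a_eq_iff: "D_a [^]\<^bsub>D_inf\<^esub> (m::int) = D_a [^]\<^bsub>D_inf\<^esub> (n::int) \<longleftrightarrow> m = n"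
  by (metis D_act_pow_D_a add_left_cancel)

lemma pow_D_a_D_b_eq_iff:
  "D_a [^]\<^bsub>D_inf\<^esub> (m::int) \<otimes>\<^bsub>D_inf\<^esub> D_b = D_a [^]\<^bsub>D_inf\<^esub> (n::int) \<otimes>\<^bsub>D_inf\<^esub> D_b \<longleftrightarrow> m = n"
  by (simp add: pow_D_a_eq_iff)

lemma pow_D_a_neq_pow_D_a_D_b:
  "D_a [^]\<^bsub>D_inf\<^esub> (m::int) \<noteq> D_a [^]\<^bsub>D_inf\<^esub> (n::int) \<otimes>\<^bsub>D_inf\<^esub> D_b"
proof
  assume "D_a [^]\<^bsub>D_inf\<^esub> m = D_a [^]\<^bsub>D_inf\<^esub> n \<otimes>\<^bsub>D_inf\<^esub> D_b"
  then have "k + m = n - k" for k by (metis D_act_pow_D_a D_act_pow_D_a_D_b)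
  \<comment> \<open>\<open>k = 0\<close> gives \<open>m = n\<close>, while \<open>k = 1\<close>
    gives \<open>m + 1 = n - 1\<close>: a translation is never a reflection.\<close>
  from this[of 0] this[of 1] show False by simp
qed

section \<open>Inversion orbits of \<open>D_inf\<close>\<close>

text \<open>The inverse is \<open>D_b\<close> times the power \<open>-n\<close> of
  \<open>D_a\<close>, and moving \<open>D_b\<close> to the right restores \<open>n\<close>. So these
  orbits are singletons.\<close>

lemma inv_pow_D_a_D_b:
  fixes n :: int
  shows "inv\<^bsub>D_inf\<^esub> (D_a [^]\<^bsub>D_inf\<^esub> n \<otimes>\<^bsub>D_inf\<^esub> D_b) = D_a [^]\<^bsub>D_inf\<^esub> n \<otimes>\<^bsub>D_inf\<^esub> D_b"
  using D_b_pow_D_a[of "- n"] by (simp add: D.inv_mult_group D.int_pow_neg inv_D_b)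

theorem lemma10p2:
  fixes K :: "('k, 'c) ring_scheme"
  assumes "field K"
  shows "pm_diag K D_inf \<cong> zero_one_functions ({n::int. 0 < n} <+> (UNIV::int set))"
proof (rule pm_diag_iso_zero_one_functions[OF assms group_D_inf])
  let ?I = "{n::int. 0 < n} <+> (UNIV::int set)"
  let ?r = "case_sum (\<lambda>n::int. D_a [^]\<^bsub>D_inf\<^esub> n) (\<lambda>n::int. D_a [^]\<^bsub>D_inf\<^esub> n \<otimes>\<^bsub>D_inf\<^esub> D_b)"
  \<comment> \<open>Written as a power, the identity can be compared with both normal forms;
    \<open>int_pow_0\<close> is disabled below to keep it so.\<close>
  have one: "\<one>\<^bsub>D_inf\<^esub> = D_a [^]\<^bsub>D_inf\<^esub> (0::int)" by simp
  note inv_pow = D.int_pow_neg[OF pres_class_D_inf, symmetric]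
  note neq = pow_D_a_neq_pow_D_a_D_b pow_D_a_neq_pow_D_a_D_b[symmetric]
  fix i assume i: "i \<in> ?I"
  show "?r i \<in> carrier D_inf" by (cases i) simp_all
  show "?r i \<noteq> \<one>\<^bsub>D_inf\<^esub>"
    using i unfolding one by (cases i) (auto simp: pow_D_a_eq_iff neq simp del: int_pow_0)
  fix j assume "j \<in> ?I" "?r i = ?r j \<or> ?r i = inv\<^bsub>D_inf\<^esub> (?r j)"
  \<comment> \<open>Two positive exponents cannot be opposite, so a power equals the inverse of
    another in no case on the left summand.\<close>
  with i show "i = j"
    by (cases i; cases j)
      (auto simp: inv_pow pow_D_a_eq_iff pow_D_a_D_b_eq_iff inv_pow_D_a_D_b neq)
next
  let ?I = "{n::int. 0 < n} <+> (UNIV::int set)"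
  let ?r = "case_sum (\<lambda>n::int. D_a [^]\<^bsub>D_inf\<^esub> n) (\<lambda>n::int. D_a [^]\<^bsub>D_inf\<^esub> n \<otimes>\<^bsub>D_inf\<^esub> D_b)"
  fix g assume g: "g \<in> carrier D_inf" "g \<noteq> \<one>\<^bsub>D_inf\<^esub>"
  from g(1) show "\<exists>i\<in>?I. g = ?r i \<or> g = inv\<^bsub>D_inf\<^esub> (?r i)"
  proof (cases rule: D_inf_normal_form)
    case (1 n)
    with g(2) have "n \<noteq> 0" by auto
    \<comment> \<open>The orbit is indexed by its positive exponent; for negative \<open>n\<close>,
      \<open>g\<close> is the inverse of the representative.\<close>
    then have "Inl \<bar>n\<bar> \<in> ?I" "g = ?r (Inl \<bar>n\<bar>) \<or> g = inv\<^bsub>D_inf\<^esub> (?r (Inl \<bar>n\<bar>))"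
      using 1 by (auto simp: abs_if D.int_pow_neg)
    then show ?thesis by blast
  next
    case (2 n)
    then show ?thesis by (intro bexI[of _ "Inr n"]) auto
  qed
qed

end
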